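(* Let $T>0$ and let $S=(S_t)_{t\in[0,T]}$ be a nonnegative càdlàg process satisfying a finite dimensional co-monotony principle. Then, for every strike price $K>0$ and every barrier $L\in(0,S_0)$, $$\mathrm{Call}_{D\&Out}(K,L,T)\ge\mathrm{Call}(K,T)\,\mathbb{P}({}_*S_T>L).$$
   Context: ${}_*S_T=\inf_{s\in[0,T]}S_s$; $S_0$ is the initial asset price; $u_+=\max(u,0)$. $\mathrm{Call}(K,T)=\mathbb{E}\,(S_T-K)_+$ is the vanilla Call premium and $\mathrm{Call}_{D\&Out}(K,L,T)=\mathbb{E}\big((S_T-K)_+\mathbf{1}_{\{{}_*S_T>L\}}\big)$ is the Down-and-Out Call premium (interest rates are zero). Two Borel functions $\Phi,\Psi:\mathbb{R}^n\to\mathbb{R}$ are componentwise co-monotone if they are both non-decreasing in each variable or both non-increasing in each variable. $S$ satisfies a finite dimensional co-monotony principle if, for every $n\ge1$ and all $0\le t_1<\cdots<t_n\le T$, the vector $Y=(S_{t_k})_{1\le k\le n}$ satisfies $\mathbb{E}\,\Phi(Y)\Psi(Y)\ge\mathbb{E}\,\Phi(Y)\,\mathbb{E}\,\Psi(Y)$ for every pair of Borel componentwise co-monotone functions with $\Phi(Y),\Psi(Y),\Phi(Y)\Psi(Y)\in L^1(\mathbb{P})$. *)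

theory Defs
  imports "HOL-Probability.Probability"
begin

definition cadlag_on :: "real \<Rightarrow> (real \<Rightarrow> real) \<Rightarrow> bool" where
  "cadlag_on T f \<longleftrightarrow>
     (\<forall>t\<in>{0..<T}. (f \<longlongrightarrow> f t) (at_right t)) \<and>
     (\<forall>t\<in>{0<..T}. \<exists>l. (f \<longlongrightarrow> l) (at_left t))"

definition nonneg_cadlag_process :: "'a measure \<Rightarrow> real \<Rightarrow> (real \<Rightarrow> 'a \<Rightarrow> real) \<Rightarrow> bool" where
  "nonneg_cadlag_process M T S \<longleftrightarrow>
     (\<forall>t\<in>{0..T}. S t \<in> borel_measurable M) \<and>
     (\<forall>\<omega>\<in>space M. \<forall>t\<in>{0..T}. 0 \<le> S t \<omega>) \<and>
     (\<forall>\<omega>\<in>space M. cadlag_on T (\<lambda>t. S t \<omega>))"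

(* The dimension n is quantified over below, so it cannot be a type: R^n with its Borel
   sigma-algebra is the finite product over the indices 1..n, whose points are the functions
   that are undefined outside {1..n}. *)
abbreviation borel_Rn :: "nat \<Rightarrow> (nat \<Rightarrow> real) measure" where
  "borel_Rn n \<equiv> Pi\<^sub>M {1..n} (\<lambda>_. borel)"

definition nondecreasing_in_each :: "nat \<Rightarrow> ((nat \<Rightarrow> real) \<Rightarrow> real) \<Rightarrow> bool" where
  "nondecreasing_in_each n \<Phi> \<longleftrightarrow>
     (\<forall>x\<in>space (borel_Rn n). \<forall>k\<in>{1..n}. mono (\<lambda>a. \<Phi> (x(k := a))))"

definition nonincreasing_in_each :: "nat \<Rightarrow> ((nat \<Rightarrow> real) \<Rightarrow> real) \<Rightarrow> bool" where
  "nonincreasing_in_each n \<Phi> \<longleftrightarrow>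
     (\<forall>x\<in>space (borel_Rn n). \<forall>k\<in>{1..n}. antimono (\<lambda>a. \<Phi> (x(k := a))))"

definition componentwise_comonotone ::
  "nat \<Rightarrow> ((nat \<Rightarrow> real) \<Rightarrow> real) \<Rightarrow> ((nat \<Rightarrow> real) \<Rightarrow> real) \<Rightarrow> bool" where
  "componentwise_comonotone n \<Phi> \<Psi> \<longleftrightarrow>
     (nondecreasing_in_each n \<Phi> \<and> nondecreasing_in_each n \<Psi>) \<or>
     (nonincreasing_in_each n \<Phi> \<and> nonincreasing_in_each n \<Psi>)"

definition comonotony_principle_vector :: "'a measure \<Rightarrow> nat \<Rightarrow> ('a \<Rightarrow> nat \<Rightarrow> real) \<Rightarrow> bool" where
  "comonotony_principle_vector M n Y \<longleftrightarrow>
     (\<forall>\<Phi>\<in>borel_measurable (borel_Rn n). \<forall>\<Psi>\<in>borel_measurable (borel_Rn n).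
        componentwise_comonotone n \<Phi> \<Psi> \<longrightarrow>
        integrable M (\<lambda>\<omega>. \<Phi> (Y \<omega>)) \<longrightarrow>
        integrable M (\<lambda>\<omega>. \<Psi> (Y \<omega>)) \<longrightarrow>
        integrable M (\<lambda>\<omega>. \<Phi> (Y \<omega>) * \<Psi> (Y \<omega>)) \<longrightarrow>
        (\<integral>\<omega>. \<Phi> (Y \<omega>) * \<Psi> (Y \<omega>) \<partial>M) \<ge> (\<integral>\<omega>. \<Phi> (Y \<omega>) \<partial>M) * (\<integral>\<omega>. \<Psi> (Y \<omega>) \<partial>M))"

definition finite_dim_comonotony_principle ::
  "'a measure \<Rightarrow> real \<Rightarrow> (real \<Rightarrow> 'a \<Rightarrow> real) \<Rightarrow> bool" where
  "finite_dim_comonotony_principle M T S \<longleftrightarrow>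
     (\<forall>n\<ge>1. \<forall>t. strict_mono_on {1..n} t \<longrightarrow> t ` {1..n} \<subseteq> {0..T} \<longrightarrow>
        comonotony_principle_vector M n (\<lambda>\<omega>. \<lambda>k\<in>{1..n}. S (t k) \<omega>))"

definition running_inf :: "(real \<Rightarrow> 'a \<Rightarrow> real) \<Rightarrow> real \<Rightarrow> 'a \<Rightarrow> real" where
  "running_inf S T \<omega> = (INF s\<in>{0..T}. S s \<omega>)"

(* No integrability of the asset price is assumed, so premia are expectations of nonnegative
   payoffs with values in [0, \<infinity>]; in the main inequality, \<infinity> * 0 = 0. *)
definition Call :: "'a measure \<Rightarrow> (real \<Rightarrow> 'a \<Rightarrow> real) \<Rightarrow> real \<Rightarrow> real \<Rightarrow> ennreal" where
  "Call M S K T = (\<integral>\<^sup>+\<omega>. ennreal (max (S T \<omega> - K) 0) \<partial>M)"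

definition Call_DOut :: "'a measure \<Rightarrow> (real \<Rightarrow> 'a \<Rightarrow> real) \<Rightarrow> real \<Rightarrow> real \<Rightarrow> real \<Rightarrow> ennreal" where
  "Call_DOut M S K L T =
     (\<integral>\<^sup>+\<omega>. ennreal (max (S T \<omega> - K) 0 * indicator {\<omega>\<in>space M. running_inf S T \<omega> > L} \<omega>) \<partial>M)"

end

theory Submission
  imports Defs
begin

text \<open>Down-and-Out survival is the increasing union over \<open>c\<close> decreasing to \<open>L\<close> of the events
  \<open>S \<ge> c\<close> on \<open>[0,T]\<close>, and by right continuity each of these is the decreasing intersection of the
  events \<open>S \<ge> c\<close> on the dyadic grid of mesh \<open>T / 2 ^ N\<close>. On such a grid the indicator of the event and
  the payoff capped at \<open>j\<close> are bounded and non-decreasing functions of the grid values, hence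
  positively correlated. Now let \<open>N\<close>, then \<open>c\<close>, then \<open>j\<close> tend to the limit. The cap
  \<open>j\<close> makes the first, decreasing, limit legitimate without integrability of the asset price.\<close>

section \<open>Dyadic grids in \<open>{0..T}\<close>\<close>

text \<open>The index is meant to run over \<open>{1..2 ^ N}\<close>, like the coordinates of
  \<open>borel_Rn\<close>. Time 0 is thus off the grid and is reached by right continuity, while the
  last point is always \<open>T\<close>, where the payoff is read.\<close>

definition dyadic_point :: "real \<Rightarrow> nat \<Rightarrow> nat \<Rightarrow> real" where
  "dyadic_point T N k = real k * T / 2 ^ N"

lemma strict_mono_on_dyadic_point: "T > 0 \<Longrightarrow> strict_mono_on A (dyadic_point T N)"
  by (auto simp: strict_mono_on_def dyadic_point_def field_simps)

lemma dyadic_point_mem: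
  assumes "T > 0" "k \<in> {1..2 ^ N}"
  shows "dyadic_point T N k \<in> {0..T}"
proof -
  have "real k \<le> 2 ^ N" using assms(2) by (simp add: of_nat_le_iff[of k "2 ^ N", simplified])
  then show ?thesis using assms by (auto simp: dyadic_point_def field_simps)
qed

lemma dyadic_point_last: "dyadic_point T N (2 ^ N) = T"
  by (simp add: dyadic_point_def)

lemma dyadic_point_Suc: "dyadic_point T (Suc N) (2 * k) = dyadic_point T N k"
  by (simp add: dyadic_point_def)

text \<open>Once the mesh is below \<open>u - t\<close>, the first grid point strictly after
  \<open>t\<close> still lies before \<open>u\<close>.\<close>

lemma dyadic_point_between:
  assumes T: "T > 0" and t: "0 \<le> t" "t < u" "u \<le> T"
  obtains N k where "k \<in> {1..2 ^ N}" "t < dyadic_point T N k" "dyadic_point T N k < u"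
proof -
  obtain N where "T / (u - t) < 2 ^ N"
    using real_arch_pow[of 2 "T / (u - t)"] by auto
  then have N: "T / 2 ^ N < u - t" using T t by (simp add: field_simps)
  \<comment> \<open>Floor plus one rather than a ceiling: the point must lie strictly after
    \<open>t\<close> even if \<open>t\<close> is on the grid.\<close>
  define k where "k = Suc (nat \<lfloor>t * 2 ^ N / T\<rfloor>)"
  have nonneg: "0 \<le> t * 2 ^ N / T" using T t by simp
  then have "real k = of_int \<lfloor>t * 2 ^ N / T\<rfloor> + 1"
    by (simp add: k_def)
  then have k: "t * 2 ^ N / T < real k" "real k \<le> t * 2 ^ N / T + 1"
    by linarith+
  have low: "t < dyadic_point T N k" using k(1) T by (simp add: dyadic_point_def field_simps)
  have "dyadic_point T N k \<le> t + T / 2 ^ N"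
    using k(2) T by (simp add: dyadic_point_def field_simps)
  then have high: "dyadic_point T N k < u" using N by simp
  have "dyadic_point T N k < T" using high t by simp
  then have "real k * T < 2 ^ N * T" using T by (simp add: dyadic_point_def field_simps)
  then have "real k < real (2 ^ N)" using T by simp
  then have "k < 2 ^ N" by (simp only: of_nat_less_iff)
  then show thesis using that[of k N] low high by (simp add: k_def)
qed

section \<open>Barrier events as countable conditions\<close>

text \<open>A value below \<open>c\<close> at a time before \<open>T\<close> persists on a right
  neighbourhood by right continuity, and that neighbourhood contains a grid point.\<close>

lemma cadlag_on_ge_iff_dyadic:
  assumes T: "T > 0" and f: "cadlag_on T f"
  shows "(\<forall>s\<in>{0..T}. c \<le> f s) \<longleftrightarrow> (\<forall>N. \<forall>k\<in>{1..2 ^ N}. c \<le> f (dyadic_point T N k))"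
proof (intro iffI ballI)
  fix s assume grid: "\<forall>N. \<forall>k\<in>{1..2 ^ N}. c \<le> f (dyadic_point T N k)" and s: "s \<in> {0..T}"
  show "c \<le> f s"
  proof (cases "s = T")
    case True
    \<comment> \<open>The end point has no right neighbourhood in the interval, but it is the single
      grid point of level 0.\<close>
    then show ?thesis using grid[rule_format, of 1 0] by (simp add: dyadic_point_def)
  next
    case False
    then have s': "s \<in> {0..<T}" using s by auto
    show ?thesis
    proof (rule ccontr)
      assume "\<not> c \<le> f s"
      moreover have "(f \<longlongrightarrow> f s) (at_right s)" using f s' by (auto simp: cadlag_on_def)
      ultimately have "\<forall>\<^sub>F x in at_right s. f x < c"
        by (intro order_tendstoD(2)) auto
      then obtain b where b: "b > s" "\<And>x. s < x \<Longrightarrow> x < b \<Longrightarrow> f x < c"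
        by (auto simp: eventually_at_right_field)
      obtain N k where "k \<in> {1..2 ^ N}" "s < dyadic_point T N k" "dyadic_point T N k < min b T"
        using s' b(1) by (auto intro: dyadic_point_between[OF T, of s "min b T"])
      then show False using grid b(2)[of "dyadic_point T N k"] by force
    qed
  qed
qed (use dyadic_point_mem[OF T] in blast)

text \<open>The infimum need not be attained, so staying above \<open>L\<close> at each time is not
  enough: a margin uniform in time is required.\<close>

lemma less_running_inf_iff:
  assumes T: "T > 0" and nonneg: "\<And>s. s \<in> {0..T} \<Longrightarrow> 0 \<le> S s \<omega>"
  shows "L < running_inf S T \<omega> \<longleftrightarrow> (\<exists>m. \<forall>s\<in>{0..T}. L + 1 / real (Suc m) \<le> S s \<omega>)"
proof
  \<comment> \<open>The real-valued \<open>INF\<close> is a genuine infimum only for sets bounded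
    below.\<close>
  have bdd: "bdd_below ((\<lambda>s. S s \<omega>) ` {0..T})"
    using nonneg by (auto intro!: bdd_belowI[of _ 0])
  assume "L < running_inf S T \<omega>"
  then obtain m where "1 / real (Suc m) < running_inf S T \<omega> - L"
    using nat_approx_posE[of "running_inf S T \<omega> - L"] by auto
  moreover have "running_inf S T \<omega> \<le> S s \<omega>" if "s \<in> {0..T}" for s
    unfolding running_inf_def by (rule cINF_lower[OF bdd that])
  ultimately show "\<exists>m. \<forall>s\<in>{0..T}. L + 1 / real (Suc m) \<le> S s \<omega>"
    by (intro exI[of _ m]) force
next
  assume "\<exists>m. \<forall>s\<in>{0..T}. L + 1 / real (Suc m) \<le> S s \<omega>"
  then obtain m where "\<forall>s\<in>{0..T}. L + 1 / real (Suc m) \<le> S s \<omega>" ..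
  then have "L + 1 / real (Suc m) \<le> running_inf S T \<omega>"
    unfolding running_inf_def using T by (intro cINF_greatest) auto
  moreover have "0 < 1 / real (Suc m)" by simp
  ultimately show "L < running_inf S T \<omega>" by linarith
qed

section \<open>Correlation of capped payoff and survival\<close>

lemma nondecreasing_in_eachI:
  assumes "\<And>x y. x \<le> y \<Longrightarrow> \<Phi> x \<le> \<Phi> y"
  shows "nondecreasing_in_each n \<Phi>"
  unfolding nondecreasing_in_each_def by (auto intro!: monoI assms simp: le_fun_def)

text \<open>The payoff is read at the last grid time, so payoff and survival are non-decreasing
  functions of one vector. Both are bounded thanks to the cap, which gives the three integrability
  conditions of the principle.\<close>

lemma capped_payoff_grid_correlation:
  fixes M :: "'a measure" and t :: "nat \<Rightarrow> real"
  assumes "prob_space M" and n: "n \<ge> 1"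
    and meas: "\<And>k. k \<in> {1..n} \<Longrightarrow> S (t k) \<in> borel_measurable M"
    and princ: "finite_dim_comonotony_principle M T S"
    and t: "strict_mono_on {1..n} t" "t ` {1..n} \<subseteq> {0..T}"
  shows "(\<integral>\<omega>. min (max (S (t n) \<omega> - K) 0) (real j) *
              indicator {\<omega>\<in>space M. \<forall>k\<in>{1..n}. c \<le> S (t k) \<omega>} \<omega> \<partial>M)
       \<ge> (\<integral>\<omega>. min (max (S (t n) \<omega> - K) 0) (real j) \<partial>M) *
           measure M {\<omega>\<in>space M. \<forall>k\<in>{1..n}. c \<le> S (t k) \<omega>}"
proof -
  interpret prob_space M by fact
  define \<Phi> where "\<Phi> x = min (max (x n - K) 0) (real j)" for x :: "nat \<Rightarrow> real"
  define \<Psi> where "\<Psi> x = (if \<forall>k\<in>{1..n}. c \<le> x k then 1 else 0 :: real)" for x :: "nat \<Rightarrow> real"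
  define Y where "Y \<omega> = (\<lambda>k\<in>{1..n}. S (t k) \<omega>)" for \<omega>
  define A where "A = {\<omega>\<in>space M. \<forall>k\<in>{1..n}. c \<le> S (t k) \<omega>}"
  have comp [measurable]: "(\<lambda>x. x k) \<in> borel_measurable (borel_Rn n)" if "k \<in> {1..n}" for k
    using that by (rule measurable_component_singleton)
  have [measurable]: "(\<lambda>x. x n) \<in> borel_measurable (borel_Rn n)"
    using n by (intro comp) simp
  have \<Phi>_meas: "\<Phi> \<in> borel_measurable (borel_Rn n)"
    unfolding \<Phi>_def by measurable
  have \<Psi>_meas: "\<Psi> \<in> borel_measurable (borel_Rn n)"
    unfolding \<Psi>_def by measurable
  have [measurable]: "S (t n) \<in> borel_measurable M" using n by (intro meas) simp
  have A [measurable]: "A \<in> sets M"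
    unfolding A_def using meas by measurable
  have \<Phi>Y: "\<Phi> (Y \<omega>) = min (max (S (t n) \<omega> - K) 0) (real j)" for \<omega>
    using n by (simp add: \<Phi>_def Y_def)
  \<comment> \<open>Restricted to \<open>space M\<close> because \<open>A\<close> is, whereas
    \<open>\<Psi>\<close> sees only path values.\<close>
  have \<Psi>Y: "\<Psi> (Y \<omega>) = indicator A \<omega>" if "\<omega> \<in> space M" for \<omega>
    using that by (auto simp: \<Psi>_def Y_def A_def indicator_def)
  have "nondecreasing_in_each n \<Phi>"
    by (rule nondecreasing_in_eachI) (auto simp: \<Phi>_def le_fun_def intro!: min.mono max.mono diff_right_mono simp del: min.bounded_iff)
  moreover have "nondecreasing_in_each n \<Psi>"
    by (rule nondecreasing_in_eachI) (auto simp: \<Psi>_def le_fun_def intro: order_trans)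
  ultimately have mono: "componentwise_comonotone n \<Phi> \<Psi>"
    by (simp add: componentwise_comonotone_def)
  have int1: "integrable M (\<lambda>\<omega>. \<Phi> (Y \<omega>))"
    unfolding \<Phi>Y by (rule integrable_const_bound[of _ "real j"]) auto
  have int2: "integrable M (\<lambda>\<omega>. \<Psi> (Y \<omega>))"
    by (subst Bochner_Integration.integrable_cong[OF refl \<Psi>Y]) (auto simp: integrable_indicator_iff less_top[symmetric])
  have "integrable M (\<lambda>\<omega>. min (max (S (t n) \<omega> - K) 0) (real j) * indicator A \<omega>)"
    by (rule integrable_const_bound[of _ "real j"]) (auto simp: indicator_def)
  then have int3: "integrable M (\<lambda>\<omega>. \<Phi> (Y \<omega>) * \<Psi> (Y \<omega>))"
    by (subst Bochner_Integration.integrable_cong[OF refl]) (auto simp: \<Phi>Y \<Psi>Y)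
  have "comonotony_principle_vector M n Y"
    using princ n t unfolding finite_dim_comonotony_principle_def Y_def by blast
  then have "(\<integral>\<omega>. \<Phi> (Y \<omega>) * \<Psi> (Y \<omega>) \<partial>M) \<ge> (\<integral>\<omega>. \<Phi> (Y \<omega>) \<partial>M) * (\<integral>\<omega>. \<Psi> (Y \<omega>) \<partial>M)"
    unfolding comonotony_principle_vector_def using \<Phi>_meas \<Psi>_meas mono int1 int2 int3 by blast
  moreover have "(\<integral>\<omega>. \<Psi> (Y \<omega>) \<partial>M) = measure M A"
    using sets.sets_into_space[OF A]
    by (subst Bochner_Integration.integral_cong[OF refl \<Psi>Y]) (auto simp: Int_absorb2)
  moreover have "(\<integral>\<omega>. \<Phi> (Y \<omega>) * \<Psi> (Y \<omega>) \<partial>M) =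
      (\<integral>\<omega>. min (max (S (t n) \<omega> - K) 0) (real j) * indicator A \<omega> \<partial>M)"
    by (rule Bochner_Integration.integral_cong) (auto simp: \<Phi>Y \<Psi>Y)
  ultimately show ?thesis
    unfolding \<Phi>Y A_def by simp
qed

text \<open>Refining the grid turns finitely many conditions into the condition at all times. The
  same countable description makes the event measurable.\<close>

lemma capped_payoff_above_level_correlation:
  fixes M :: "'a measure" and c :: real
  assumes "prob_space M" and T: "T > 0" and S: "nonneg_cadlag_process M T S"
    and princ: "finite_dim_comonotony_principle M T S"
  defines "A \<equiv> {\<omega>\<in>space M. \<forall>s\<in>{0..T}. c \<le> S s \<omega>}"
  shows "A \<in> sets M"
    and "(\<integral>\<omega>. min (max (S T \<omega> - K) 0) (real j) * indicator A \<omega> \<partial>M)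
       \<ge> (\<integral>\<omega>. min (max (S T \<omega> - K) 0) (real j) \<partial>M) * measure M A"
proof -
  interpret prob_space M by fact
  define B where "B N = {\<omega>\<in>space M. \<forall>k\<in>{1..2 ^ N}. c \<le> S (dyadic_point T N k) \<omega>}" for N
  define f where "f \<omega> = min (max (S T \<omega> - K) 0) (real j)" for \<omega>
  have meas: "S s \<in> borel_measurable M" if "s \<in> {0..T}" for s
    using S that by (auto simp: nonneg_cadlag_process_def)
  have [measurable]: "S T \<in> borel_measurable M" using T by (intro meas) simp
  have [measurable]: "f \<in> borel_measurable M" unfolding f_def by measurable
  have B [measurable]: "B N \<in> sets M" for N
    unfolding B_def using meas[OF dyadic_point_mem[OF T]] by measurable
  have "(\<forall>s\<in>{0..T}. c \<le> S s \<omega>) \<longleftrightarrow> (\<forall>N. \<forall>k\<in>{1..2 ^ N}. c \<le> S (dyadic_point T N k) \<omega>)"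
    if "\<omega> \<in> space M" for \<omega>
    using S that by (intro cadlag_on_ge_iff_dyadic[OF T]) (auto simp: nonneg_cadlag_process_def)
  then have A_eq: "A = (\<Inter>N. B N)"
    unfolding A_def B_def by blast
  show A [measurable]: "A \<in> sets M" unfolding A_eq by measurable
  \<comment> \<open>The grids are nested: point \<open>k\<close> of level \<open>N\<close> is point
    \<open>2 * k\<close> of the next level.\<close>
  have "B (Suc N) \<subseteq> B N" for N
  proof
    fix \<omega> assume \<omega>: "\<omega> \<in> B (Suc N)"
    have "c \<le> S (dyadic_point T N k) \<omega>" if "k \<in> {1..2 ^ N}" for k
    proof -
      have "2 * k \<in> {1..2 ^ Suc N}" using that by auto
      then have "c \<le> S (dyadic_point T (Suc N) (2 * k)) \<omega>" using \<omega> unfolding B_def by blast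
      then show ?thesis by (simp only: dyadic_point_Suc)
    qed
    then show "\<omega> \<in> B N" using \<omega> by (auto simp: B_def)
  qed
  then have dec: "decseq B" by (rule decseq_SucI)
  have lim: "(\<lambda>N. \<integral>\<omega>. f \<omega> * indicator (B N) \<omega> \<partial>M) \<longlonglongrightarrow> (\<integral>\<omega>. f \<omega> * indicator A \<omega> \<partial>M)"
  proof (rule integral_dominated_convergence)
    show "AE \<omega> in M. (\<lambda>N. f \<omega> * indicator (B N) \<omega>) \<longlonglongrightarrow> f \<omega> * indicator A \<omega>"
      unfolding A_eq by (intro AE_I2 tendsto_mult tendsto_const LIMSEQ_indicator_decseq dec)
    show "AE \<omega> in M. norm (f \<omega> * indicator (B N) \<omega>) \<le> real j" for N
      by (auto simp: f_def indicator_def)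
  qed auto
  \<comment> \<open>Only the right-hand side needs a limit: \<open>A\<close> lies in every
    \<open>B N\<close> and the mean of \<open>f\<close> is nonnegative.\<close>
  have "(\<integral>\<omega>. f \<omega> \<partial>M) * measure M A \<le> (\<integral>\<omega>. f \<omega> * indicator (B N) \<omega> \<partial>M)" for N
  proof -
    have "(\<integral>\<omega>. f \<omega> \<partial>M) * measure M A \<le> (\<integral>\<omega>. f \<omega> \<partial>M) * measure M (B N)"
      by (intro mult_left_mono finite_measure_mono Bochner_Integration.integral_nonneg)
        (auto simp: A_eq f_def)
    also have "\<dots> \<le> (\<integral>\<omega>. f \<omega> * indicator (B N) \<omega> \<partial>M)"
    proof -
      have "dyadic_point T N ` {1..2 ^ N} \<subseteq> {0..T}"
        using dyadic_point_mem[OF T] by blast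
      then show ?thesis
        using capped_payoff_grid_correlation[where n = "2 ^ N" and t = "dyadic_point T N" and S = S,
            OF prob_space_axioms _ meas[OF dyadic_point_mem[OF T]] princ strict_mono_on_dyadic_point[OF T]]
        unfolding f_def B_def dyadic_point_last by simp
    qed
    finally show ?thesis .
  qed
  then show "(\<integral>\<omega>. min (max (S T \<omega> - K) 0) (real j) * indicator A \<omega> \<partial>M)
       \<ge> (\<integral>\<omega>. min (max (S T \<omega> - K) 0) (real j) \<partial>M) * measure M A"
    unfolding f_def[symmetric] by (intro LIMSEQ_le_const[OF lim] exI allI impI)
qed

text \<open>Monotone convergence, since the caps increase to \<open>f\<close> and are eventually
  inactive at each point. An infinite integral is allowed.\<close>

lemma nn_integral_eq_SUP_capped:
  assumes [measurable]: "f \<in> borel_measurable M"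
  shows "(\<integral>\<^sup>+\<omega>. ennreal (f \<omega>) \<partial>M) = (SUP j. \<integral>\<^sup>+\<omega>. ennreal (min (f \<omega>) (real j)) \<partial>M)"
proof -
  have capped: "ennreal x = (SUP j. ennreal (min x (real j)))" for x
  proof (rule antisym)
    obtain j where "x \<le> real j" using real_arch_simple by blast
    then show "ennreal x \<le> (SUP j. ennreal (min x (real j)))"
      by (intro SUP_upper2[of j]) auto
    show "(SUP j. ennreal (min x (real j))) \<le> ennreal x"
      by (intro SUP_least ennreal_leI) auto
  qed
  have "(\<integral>\<^sup>+\<omega>. ennreal (f \<omega>) \<partial>M) = (\<integral>\<^sup>+\<omega>. (SUP j. ennreal (min (f \<omega>) (real j))) \<partial>M)"
    by (rule nn_integral_cong) (rule capped)
  also have "\<dots> = (SUP j. \<integral>\<^sup>+\<omega>. ennreal (min (f \<omega>) (real j)) \<partial>M)"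
    by (rule nn_integral_monotone_convergence_SUP)
      (auto simp: incseq_def le_fun_def intro!: ennreal_leI)
  finally show ?thesis .
qed

theorem mainTheorem19:
  fixes M :: "'a measure" and S :: "real \<Rightarrow> 'a \<Rightarrow> real" and T K L :: real
  assumes "prob_space M"
    and "T > 0"
    and "nonneg_cadlag_process M T S"
    and "finite_dim_comonotony_principle M T S"
    and "K > 0"
    and "AE \<omega> in M. L \<in> {0<..<S 0 \<omega>}"
  shows "Call_DOut M S K L T \<ge> Call M S K T * ennreal (\<P>(\<omega> in M. running_inf S T \<omega> > L))"
proof -
  interpret prob_space M by fact
  define f where "f \<omega> = max (S T \<omega> - K) 0" for \<omega>
  define A where "A m = {\<omega>\<in>space M. \<forall>s\<in>{0..T}. L + 1 / real (Suc m) \<le> S s \<omega>}" for m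
  define B where "B = {\<omega>\<in>space M. running_inf S T \<omega> > L}"
  note corr = capped_payoff_above_level_correlation[OF assms(1-4)]
  have [measurable]: "S T \<in> borel_measurable M"
    using assms(2,3) by (auto simp: nonneg_cadlag_process_def)
  have [measurable]: "f \<in> borel_measurable M" unfolding f_def by measurable
  have A [measurable]: "A m \<in> sets M" for m
    unfolding A_def by (rule corr(1))
  have "L < running_inf S T \<omega> \<longleftrightarrow> (\<exists>m. \<forall>s\<in>{0..T}. L + 1 / real (Suc m) \<le> S s \<omega>)"
    if "\<omega> \<in> space M" for \<omega>
    using assms(3) that by (intro less_running_inf_iff assms(2)) (auto simp: nonneg_cadlag_process_def)
  then have B_eq: "B = (\<Union>m. A m)" unfolding A_def B_def by blast
  have [measurable]: "B \<in> sets M" unfolding B_eq by measurable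
  have "incseq A"
  proof (rule incseq_SucI)
    fix m
    have "1 / real (Suc (Suc m)) \<le> 1 / real (Suc m)" by (simp add: field_simps)
    then show "A m \<subseteq> A (Suc m)" unfolding A_def by force
  qed
  then have emB: "emeasure M B = (SUP m. emeasure M (A m))"
    unfolding B_eq by (intro SUP_emeasure_incseq[symmetric]) auto
  \<comment> \<open>For fixed \<open>j\<close> and \<open>m\<close> both factors are finite, so the
    real inequality transfers to \<open>ennreal\<close>; afterwards the cap is dropped and
    \<open>A m\<close> enlarged to \<open>B\<close>.\<close>
  have bound: "(\<integral>\<^sup>+\<omega>. ennreal (min (f \<omega>) (real j)) \<partial>M) * emeasure M (A m) \<le> Call_DOut M S K L T" for j m
  proof -
    have int: "integrable M (\<lambda>\<omega>. min (f \<omega>) (real j))"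
      by (rule integrable_const_bound[of _ "real j"]) (auto simp: f_def)
    have int': "integrable M (\<lambda>\<omega>. min (f \<omega>) (real j) * indicator (A m) \<omega>)"
      by (rule integrable_const_bound[of _ "real j"]) (auto simp: f_def indicator_def)
    have "(\<integral>\<^sup>+\<omega>. ennreal (min (f \<omega>) (real j)) \<partial>M) * emeasure M (A m) =
        ennreal ((\<integral>\<omega>. min (f \<omega>) (real j) \<partial>M) * measure M (A m))"
      by (subst nn_integral_eq_integral[OF int])
        (auto simp: f_def emeasure_eq_measure ennreal_mult intro!: Bochner_Integration.integral_nonneg)
    also have "\<dots> \<le> ennreal (\<integral>\<omega>. min (f \<omega>) (real j) * indicator (A m) \<omega> \<partial>M)"
      unfolding f_def A_def by (intro ennreal_leI corr(2))
    also have "\<dots> = (\<integral>\<^sup>+\<omega>. ennreal (min (f \<omega>) (real j) * indicator (A m) \<omega>) \<partial>M)"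
      by (rule nn_integral_eq_integral[OF int', symmetric]) (auto simp: f_def)
    also have "\<dots> \<le> (\<integral>\<^sup>+\<omega>. ennreal (f \<omega> * indicator B \<omega>) \<partial>M)"
      by (intro nn_integral_mono ennreal_leI) (auto simp: B_eq f_def indicator_def)
    finally show ?thesis by (simp add: Call_DOut_def f_def B_def)
  qed
  \<comment> \<open>Both remaining limits are suprema, and multiplication in \<open>ennreal\<close>
    commutes with them, also when the Call premium is infinite or the survival probability is
    0.\<close>
  have "Call M S K T * emeasure M B =
      (SUP j. SUP m. (\<integral>\<^sup>+\<omega>. ennreal (min (f \<omega>) (real j)) \<partial>M) * emeasure M (A m))"
    unfolding Call_def f_def[symmetric] emB
    by (subst nn_integral_eq_SUP_capped, simp, subst SUP_commute)
      (simp add: SUP_mult_left_ennreal SUP_mult_right_ennreal)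
  also have "\<dots> \<le> Call_DOut M S K L T"
    by (intro SUP_least bound)
  finally show ?thesis by (simp add: emeasure_eq_measure B_def)
qed

end
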